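(* Let $\chi(x)=\bigl(\mu(x)/\widehat\mu(x)\bigr)^{1/2}$ for $x\in\mathcal X$. For any $x\in\operatorname{supp}(\mathrm P)$, any $f\in L^2_{\mathrm P}$ and any integer $m>0$, \[ \bigl\lVert\mathbf R_x-\widehat{\mathbf R}_x\bigr\rVert_{L^2_{\mathrm P}}\le\mu(x)^{-1/2}\Bigl((m-1)\lVert\chi\rVert_\infty\lVert\widehat{\mathcal Q}-\mathcal G\rVert_\infty\bigl(1+\lVert\widehat{\mathcal Q}-\mathcal G\rVert_\infty\bigr)^{m-2}+\lVert\chi-1\rVert_\infty\Bigr) \] and \[ \Bigl(\int\bigl\langle\mathbf R_x-\widehat{\mathbf R}_x,f\bigr\rangle_{L^2_{\mathrm P}}^2\,\mathrm d\mathrm P(x)\Bigr)^{1/2}\le\lVert f\rVert_{L^2_{\mathrm P}}\Bigl((m-1)\lVert\chi\rVert_\infty\lVert\widehat{\mathcal Q}-\mathcal G\rVert_\infty\bigl(1+\lVert\widehat{\mathcal Q}-\mathcal G\rVert_\infty\bigr)^{m-2}+\lVert\chi-1\rVert_\infty\Bigr). \]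
   Context: Setting: $\mathcal X$ is a compact subset of a separable Hilbert space, $\mathrm P$ is a Borel probability measure on $\mathcal X$ whose support is a union of several compact connected components, $\beta>0$, and $K(x,y)=\exp(-\beta\|x-y\|^2)$ for $x,y\in\mathcal X$. $\mathcal H$ is the reproducing kernel Hilbert space of $K$, with feature map $\phi_K:\mathcal X\to\mathcal H$, $K(x,y)=\langle\phi_K(x),\phi_K(y)\rangle_{\mathcal H}$. Ideal objects: $\mu(x)=\int K(x,z)\,\mathrm d\mathrm P(z)$, $\phi_{\overline K}(x)=\mu(x)^{-1/2}\phi_K(x)$, and $\mathcal G:\mathcal H\to\mathcal H$, $\mathcal G v=\int\langle v,\phi_{\overline K}(z)\rangle_{\mathcal H}\,\phi_{\overline K}(z)\,\mathrm d\mathrm P(z)$. Empirical objects: $X_1,\dots,X_n\in\mathcal X$ is an i.i.d. sample drawn according to $\mathrm P$; $\widehat\mu(x)=\frac1n\sum_{i=1}^nK(x,X_i)$, $\phi_{\widehat K}(x)=\widehat\mu(x)^{-1/2}\phi_K(x)$, and \[ \widehat{\mathcal Q}v=\frac1n\sum_{i=1}^n\widehat\mu(X_i)^{-1}\langle v,\phi_K(X_i)\rangle_{\mathcal H}\,\phi_K(X_i),\qquad v\in\mathcal H. \] Representations: for $x\in\mathcal X$, the functions $\mathbf R_x,\widehat{\mathbf R}_x\in L^2_{\mathrm P}$ are \[ \mathbf R_x(y)=\langle\mathcal G^{m-1}\phi_{\overline K}(x),\phi_{\overline K}(y)\rangle_{\mathcal H},\qquad \widehat{\mathbf R}_x(y)=\langle\widehat{\mathcal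 Q}^{m-1}\phi_{\widehat K}(x),\phi_{\overline K}(y)\rangle_{\mathcal H}, \] where the zeroth power of an operator is the identity. Norms: $\lVert\cdot\rVert_\infty$ is the operator norm for operators on $\mathcal H$ and the supremum norm over $\mathcal X$ for functions on $\mathcal X$. *)

theory Defs
  imports "HOL-Probability.Probability"
begin

definition gauss_kernel :: "real \<Rightarrow> 'a::real_inner \<Rightarrow> 'a \<Rightarrow> real"
  where "gauss_kernel \<beta> x y = exp (- \<beta> * (norm (x - y))\<^sup>2)"

(* The elements of the Hilbert space 'h are functions on X through the evaluation map evl:
   evl v x is the value at x of the function v. Injectivity says that an element of 'h is
   determined by its values on X; k is the kernel section K(x, .), and evaluation at x is
   the inner product with k. *)
definition is_rkhs ::
    "'a set \<Rightarrow> ('a \<Rightarrow> 'a \<Rightarrow> real) \<Rightarrow> ('h::{real_inner,complete_space} \<Rightarrow> 'a \<Rightarrow> real) \<Rightarrow> bool"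
  where "is_rkhs X K evl \<longleftrightarrow>
    (\<forall>x\<in>X. linear (\<lambda>v. evl v x)) \<and>
    (\<forall>u v. (\<forall>x\<in>X. evl u x = evl v x) \<longrightarrow> u = v) \<and>
    (\<forall>x\<in>X. \<exists>k. (\<forall>y\<in>X. evl k y = K x y) \<and> (\<forall>v. evl v x = inner v k))"

definition measure_supp :: "'a::topological_space measure \<Rightarrow> 'a set"
  where "measure_supp P =
    {x \<in> space P. \<forall>U. open U \<longrightarrow> x \<in> U \<longrightarrow> emeasure P (U \<inter> space P) > 0}"

definition in_L2 :: "'a measure \<Rightarrow> ('a \<Rightarrow> real) \<Rightarrow> bool"
  where "in_L2 P f \<longleftrightarrow> f \<in> borel_measurable P \<and> integrable P (\<lambda>y. (f y)\<^sup>2)"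

definition L2_inner :: "'a measure \<Rightarrow> ('a \<Rightarrow> real) \<Rightarrow> ('a \<Rightarrow> real) \<Rightarrow> real"
  where "L2_inner P f g = (LINT y|P. f y * g y)"

definition L2_nrm :: "'a measure \<Rightarrow> ('a \<Rightarrow> real) \<Rightarrow> real"
  where "L2_nrm P f = sqrt (LINT y|P. (f y)\<^sup>2)"

definition sup_nrm :: "'a set \<Rightarrow> ('a \<Rightarrow> real) \<Rightarrow> real"
  where "sup_nrm X f = (SUP x\<in>X. \<bar>f x\<bar>)"

definition mu :: "'a::real_inner measure \<Rightarrow> real \<Rightarrow> 'a \<Rightarrow> real"
  where "mu P \<beta> x = (LINT z|P. gauss_kernel \<beta> x z)"

definition mu_hat :: "nat \<Rightarrow> (nat \<Rightarrow> 'a::real_inner) \<Rightarrow> real \<Rightarrow> 'a \<Rightarrow> real"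
  where "mu_hat n xs \<beta> x = 1 / real n * (\<Sum>i=1..n. gauss_kernel \<beta> x (xs i))"

definition phi_bar ::
    "'a::real_inner measure \<Rightarrow> real \<Rightarrow> ('a \<Rightarrow> 'h::real_vector) \<Rightarrow> 'a \<Rightarrow> 'h"
  where "phi_bar P \<beta> \<phi> x = (mu P \<beta> x powr (-1/2)) *\<^sub>R \<phi> x"

definition phi_hat ::
    "nat \<Rightarrow> (nat \<Rightarrow> 'a::real_inner) \<Rightarrow> real \<Rightarrow> ('a \<Rightarrow> 'h::real_vector) \<Rightarrow> 'a \<Rightarrow> 'h"
  where "phi_hat n xs \<beta> \<phi> x = (mu_hat n xs \<beta> x powr (-1/2)) *\<^sub>R \<phi> x"

definition G_op ::
    "'a::real_inner measure \<Rightarrow> real \<Rightarrow> ('a \<Rightarrow> 'h) \<Rightarrow>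
     'h::{real_inner,banach,second_countable_topology} \<Rightarrow> 'h"
  where "G_op P \<beta> \<phi> v = (LINT z|P. inner v (phi_bar P \<beta> \<phi> z) *\<^sub>R phi_bar P \<beta> \<phi> z)"

definition Q_hat ::
    "nat \<Rightarrow> (nat \<Rightarrow> 'a::real_inner) \<Rightarrow> real \<Rightarrow> ('a \<Rightarrow> 'h) \<Rightarrow> 'h::real_inner \<Rightarrow> 'h"
  where "Q_hat n xs \<beta> \<phi> v =
    (1 / real n) *\<^sub>R
      (\<Sum>i=1..n. (inverse (mu_hat n xs \<beta> (xs i)) * inner v (\<phi> (xs i))) *\<^sub>R \<phi> (xs i))"

definition R_rep ::
    "'a::real_inner measure \<Rightarrow> real \<Rightarrow>
     ('a \<Rightarrow> 'h::{real_inner,banach,second_countable_topology}) \<Rightarrow> nat \<Rightarrow> 'a \<Rightarrow> 'a \<Rightarrow> real"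
  where "R_rep P \<beta> \<phi> m x y =
    inner ((G_op P \<beta> \<phi> ^^ (m - 1)) (phi_bar P \<beta> \<phi> x)) (phi_bar P \<beta> \<phi> y)"

(* As in the ideal case the second argument is the ideal feature phi_bar, not phi_hat. *)
definition R_hat ::
    "'a::real_inner measure \<Rightarrow> nat \<Rightarrow> (nat \<Rightarrow> 'a) \<Rightarrow> real \<Rightarrow>
     ('a \<Rightarrow> 'h::real_inner) \<Rightarrow> nat \<Rightarrow> 'a \<Rightarrow> 'a \<Rightarrow> real"
  where "R_hat P n xs \<beta> \<phi> m x y =
    inner ((Q_hat n xs \<beta> \<phi> ^^ (m - 1)) (phi_hat n xs \<beta> \<phi> x)) (phi_bar P \<beta> \<phi> y)"

definition chi ::
    "'a::real_inner measure \<Rightarrow> nat \<Rightarrow> (nat \<Rightarrow> 'a) \<Rightarrow> real \<Rightarrow> 'a \<Rightarrow> real"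
  where "chi P n xs \<beta> x = sqrt (mu P \<beta> x / mu_hat n xs \<beta> x)"

end

theory Submission
  imports Defs
begin

text \<open>
  Write \<open>S v = (\<lambda>z. inner v (phi_bar z))\<close>, so that \<open>G = S\<^sup>* S\<close>. The Schur test with the weights
  \<open>\<mu>\<close> shows that \<open>S\<^sup>*\<close>, hence \<open>S\<close> and \<open>G\<close>, are contractions. Since \<open>phi_hat x = \<chi> x *\<^sub>R phi_bar x\<close>, the
  difference of the two representations of \<open>x\<close> is \<open>S\<close> applied to
  \<open>(1 - \<chi> x) G\<^sup>k (phi_bar x) + \<chi> x (G\<^sup>k - Q\<^sup>k) (phi_bar x)\<close> with \<open>k = m - 1\<close>, and telescoping gives
  \<open>norm (G\<^sup>k - Q\<^sup>k) \<le> k \<delta> (1 + \<delta>)\<^sup>k\<^sup>-\<^sup>1\<close>. For the second bound, self-adjointness moves the powers onto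
  \<open>S\<^sup>* f\<close>, so that contractivity of \<open>S\<close> can be used again, in the variable \<open>x\<close>.
\<close>

section \<open>Powers of an operator and of a perturbation of it\<close>

lemma funpow_inner_commute:
  fixes A :: "'h::real_inner \<Rightarrow> 'h"
  assumes "\<And>u v. inner (A u) v = inner u (A v)"
  shows "inner ((A ^^ k) u) v = inner u ((A ^^ k) v)"
  by (induction k arbitrary: u v) (auto simp: assms funpow_swap1)

lemma funpow_bounded_linear:
  fixes A :: "'h::real_normed_vector \<Rightarrow> 'h"
  assumes "bounded_linear A"
  shows "bounded_linear (A ^^ k)"
proof (induction k)
  case 0
  then show ?case by (simp add: bounded_linear_ident id_def)
next
  case (Suc k)
  then show ?case
    using bounded_linear_compose[OF assms Suc] by (simp add: o_def)
qed

lemma funpow_norm_le: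
  fixes A :: "'h::real_normed_vector \<Rightarrow> 'h"
  assumes "\<And>v. norm (A v) \<le> r * norm v" and "0 \<le> r"
  shows "norm ((A ^^ k) v) \<le> r ^ k * norm v"
proof (induction k)
  case (Suc k)
  have "norm ((A ^^ Suc k) v) \<le> r * norm ((A ^^ k) v)"
    using assms(1) by simp
  also have "\<dots> \<le> r * (r ^ k * norm v)"
    using Suc assms(2) by (rule mult_left_mono)
  finally show ?case by simp
qed simp

text \<open>Telescoping one factor at a time: the difference of the powers \<open>Suc k\<close> is
  \<open>A\<close> applied to the difference of the powers \<open>k\<close>, minus
  \<open>B - A\<close> applied to \<open>(B ^^ k) v\<close>. The contraction \<open>A\<close> does
  not enlarge the old error, and the new error is at most \<open>d * (1 + d) ^ k * norm v\<close>,
  since \<open>B\<close> is within \<open>d\<close> of a contraction.\<close>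

lemma funpow_diff_norm_le:
  fixes A B :: "'h::real_normed_vector \<Rightarrow> 'h"
  assumes "linear A" and A: "\<And>v. norm (A v) \<le> norm v"
    and d: "\<And>v. norm (B v - A v) \<le> d * norm v" and "0 \<le> d"
  shows "norm ((A ^^ k) v - (B ^^ k) v) \<le> real k * d * (1 + d) ^ (k - 1) * norm v"
proof (induction k)
  case (Suc k)
  have B: "norm (B v) \<le> (1 + d) * norm v" for v
    using norm_triangle_ineq[of "B v - A v" "A v"] A[of v] d[of v] by (simp add: algebra_simps)
  have "(A ^^ Suc k) v - (B ^^ Suc k) v
      = A ((A ^^ k) v - (B ^^ k) v) - (B ((B ^^ k) v) - A ((B ^^ k) v))"
    using \<open>linear A\<close> by (simp add: linear_diff)
  also have "norm \<dots> \<le> norm ((A ^^ k) v - (B ^^ k) v) + d * norm ((B ^^ k) v)"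
    by (rule order_trans[OF norm_triangle_ineq4 add_mono[OF A d]])
  also have "\<dots> \<le> real k * d * (1 + d) ^ (k - 1) * norm v + d * ((1 + d) ^ k * norm v)"
    using Suc funpow_norm_le[OF B] \<open>0 \<le> d\<close> by (intro add_mono mult_left_mono) auto
  \<comment> \<open>Raising the exponent \<open>k - 1\<close> to \<open>k\<close> gives both terms
    the common factor \<open>d * (1 + d) ^ k * norm v\<close>, so that the coefficients
    \<open>k\<close> and 1 add up to \<open>Suc k\<close>.\<close>
  also have "\<dots> \<le> real k * d * (1 + d) ^ k * norm v + d * ((1 + d) ^ k * norm v)"
    using \<open>0 \<le> d\<close>
    by (intro add_mono order_refl mult_right_mono mult_left_mono power_increasing) auto
  finally show ?case by (simp add: algebra_simps)
qed simp

section \<open>Feature maps normalized by their degree, over a probability space\<close>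

locale normalized_features = prob_space P
  for P :: "'a measure" +
  fixes \<phi> :: "'a \<Rightarrow> 'h::{real_inner,banach,second_countable_topology}" and c :: real
  assumes measurable_feature [measurable]: "\<phi> \<in> borel_measurable P"
    and norm_feature_le: "z \<in> space P \<Longrightarrow> norm (\<phi> z) \<le> 1"
    and inner_feature_nonneg: "y \<in> space P \<Longrightarrow> z \<in> space P \<Longrightarrow> 0 \<le> inner (\<phi> y) (\<phi> z)"
    and c_pos: "0 < c"
    and mass_ge: "z \<in> space P \<Longrightarrow> c \<le> inner (\<phi> z) (LINT w|P. \<phi> w)"
begin

text \<open>This is the degree \<mu> of the kernel \<open>inner (\<phi> y) (\<phi> z)\<close>,
  written as a pairing with the mean embedding \<open>LINT w|P. \<phi> w\<close>. In this form its
  measurability is immediate, and integrating the kernel in one variable becomes an inner product in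
  \<open>'h\<close>.\<close>

definition mass :: "'a \<Rightarrow> real"
  where "mass z = inner (\<phi> z) (LINT w|P. \<phi> w)"

definition feature :: "'a \<Rightarrow> 'h"
  where "feature z = mass z powr (-1/2) *\<^sub>R \<phi> z"

definition synth :: "('a \<Rightarrow> real) \<Rightarrow> 'h"
  where "synth f = (LINT z|P. f z *\<^sub>R feature z)"

definition gram :: "'h \<Rightarrow> 'h"
  where "gram v = synth (\<lambda>z. inner v (feature z))"

lemma mass_pos: "z \<in> space P \<Longrightarrow> 0 < mass z"
  unfolding mass_def by (rule less_le_trans[OF c_pos mass_ge])

lemma measurable_mass [measurable]: "mass \<in> borel_measurable P"
  unfolding mass_def by measurable

lemma measurable_normalized_feature [measurable]: "feature \<in> borel_measurable P"
  unfolding feature_def by measurable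

lemma inner_normalized_feature:
  "inner (feature y) (feature z) = inner (\<phi> y) (\<phi> z) * mass y powr (-1/2) * mass z powr (-1/2)"
  by (simp add: feature_def)

lemma norm_normalized_feature_le: "norm (feature z) \<le> c powr (-1/2)" if "z \<in> space P"
proof -
  have "mass z powr (-1/2) \<le> c powr (-1/2)"
    using mass_ge[OF that] c_pos by (intro powr_mono2') (auto simp: mass_def)
  then have "mass z powr (-1/2) * norm (\<phi> z) \<le> c powr (-1/2) * 1"
    using norm_feature_le[OF that] by (intro mult_mono) auto
  then show ?thesis by (simp add: feature_def)
qed

lemma integrable_feature: "integrable P \<phi>"
  by (rule integrable_const_bound[where B = 1]) (auto intro: norm_feature_le)

lemma in_L2_integrable: "integrable P f" if "in_L2 P f"
  using that unfolding in_L2_def by (rule conjE) (rule square_integrable_imp_integrable)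

lemma integrable_scaleR_bounded:
  fixes g :: "'a \<Rightarrow> 'b::{banach,second_countable_topology}"
  assumes f: "integrable P f" and [measurable]: "g \<in> borel_measurable P"
    and "\<And>z. z \<in> space P \<Longrightarrow> norm (g z) \<le> b"
  shows "integrable P (\<lambda>z. f z *\<^sub>R g z)"
proof (rule Bochner_Integration.integrable_bound)
  show "integrable P (\<lambda>z. b * f z)" using f by simp
  show "(\<lambda>z. f z *\<^sub>R g z) \<in> borel_measurable P"
    using borel_measurable_integrable[OF f] by measurable
  have "\<bar>f z\<bar> * norm (g z) \<le> \<bar>b * f z\<bar>" if "z \<in> space P" for z
  proof -
    have "\<bar>f z\<bar> * norm (g z) \<le> \<bar>f z\<bar> * \<bar>b\<bar>"
      using assms(3)[OF that] by (intro mult_left_mono) auto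
    then show ?thesis by (simp add: abs_mult mult.commute)
  qed
  then show "AE z in P. norm (f z *\<^sub>R g z) \<le> norm (b * f z)"
    by auto
qed

lemma integrable_synth: "integrable P (\<lambda>z. f z *\<^sub>R feature z)" if "integrable P f"
  using integrable_scaleR_bounded[OF that _ norm_normalized_feature_le] by simp

text \<open>The bounded functional \<open>inner v\<close> commutes with the Bochner integral. Hence
  \<open>synth\<close> is adjoint to the map from \<open>v\<close> to
  \<open>\<lambda>z. inner v (feature z)\<close>; these are \<open>S\<^sup>*\<close> and
  \<open>S\<close> of the overview.\<close>

lemma inner_synth:
  assumes "integrable P f"
  shows "inner v (synth f) = (LINT z|P. inner v (feature z) * f z)"
proof -
  have "inner v (synth f) = (LINT z|P. inner v (f z *\<^sub>R feature z))"
    unfolding synth_def using integrable_synth[OF assms] by (intro integral_inner_right[symmetric]) simp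
  then show ?thesis by (simp add: mult.commute)
qed

lemma in_L2_inner_feature: "in_L2 P (\<lambda>z. inner v (feature z))"
proof -
  have le: "norm (inner v (feature z)) \<le> norm v * c powr (-1/2)" if "z \<in> space P" for z
    using Cauchy_Schwarz_ineq2[of v "feature z"]
      mult_left_mono[OF norm_normalized_feature_le[OF that], of "norm v"] by simp
  have "norm ((inner v (feature z))\<^sup>2) \<le> (norm v * c powr (-1/2))\<^sup>2" if "z \<in> space P" for z
    using power_mono[OF le[OF that], of 2] by simp
  then have "integrable P (\<lambda>z. (inner v (feature z))\<^sup>2)"
    by (intro integrable_const_bound[where B = "(norm v * c powr (-1/2))\<^sup>2"]) auto
  then show ?thesis by (simp add: in_L2_def)
qed

text \<open>The Schur test with weights \<open>mass powr (-1/2)\<close>. The iterated integral is evaluated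
  through the Bochner integral of the vector-valued function \<open>\<lambda>w. (f w)\<^sup>2 / mass w *\<^sub>R \<phi> w\<close>, which
  makes Fubini's theorem unnecessary.\<close>

lemma norm_synth_le:
  assumes f: "in_L2 P f"
  shows "(norm (synth f))\<^sup>2 \<le> (LINT z|P. (f z)\<^sup>2)"
proof -
  have fm [measurable]: "f \<in> borel_measurable P" and f2: "integrable P (\<lambda>z. (f z)\<^sup>2)"
    using f by (auto simp: in_L2_def)
  note fi = in_L2_integrable[OF f]
  define g where "g w = (f w)\<^sup>2 / mass w" for w
  have gi: "integrable P g"
  proof -
    have "integrable P (\<lambda>w. (f w)\<^sup>2 *\<^sub>R (1 / mass w))"
    proof (rule integrable_scaleR_bounded[OF f2])
      show "norm (1 / mass w) \<le> 1 / c" if "w \<in> space P" for w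
        using mass_ge[OF that] c_pos mass_pos[OF that] by (simp add: mass_def frac_le)
    qed measurable
    then show ?thesis by (simp add: g_def [abs_def])
  qed
  have gphi: "integrable P (\<lambda>w. g w *\<^sub>R \<phi> w)"
    using integrable_scaleR_bounded[OF gi _ norm_feature_le] by simp
  define V where "V = (LINT w|P. g w *\<^sub>R \<phi> w)"
  have pointwise: "inner (synth f) (feature z) * f z \<le> (f z)\<^sup>2 / 2 + inner (\<phi> z) V / 2"
    if z: "z \<in> space P" for z
  proof -
    have "inner (synth f) (feature z) * f z
        = (LINT w|P. inner (feature z) (feature w) * f w) * f z"
      by (simp add: inner_synth[OF fi] inner_commute[of "synth f"])
    also have "\<dots> = (LINT w|P. inner (feature z) (f w *\<^sub>R feature w) * f z)"
      by (simp add: mult.commute)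
    also have "\<dots> \<le> (LINT w|P. g z / 2 * inner (\<phi> z) (\<phi> w) + inner (\<phi> z) (g w *\<^sub>R \<phi> w) / 2)"
    proof (rule integral_mono)
      show "integrable P (\<lambda>w. inner (feature z) (f w *\<^sub>R feature w) * f z)"
        using integrable_synth[OF fi] by (intro integrable_mult_left integrable_inner_right) auto
      show "integrable P (\<lambda>w. g z / 2 * inner (\<phi> z) (\<phi> w) + inner (\<phi> z) (g w *\<^sub>R \<phi> w) / 2)"
        using integrable_feature gphi
        by (intro Bochner_Integration.integrable_add integrable_mult_right integrable_divide
            integrable_inner_right) auto
      fix w assume w: "w \<in> space P"
      \<comment> \<open>Each value of \<open>f\<close> takes the normalizing factor of its own
        point, so that \<open>p\<^sup>2\<close> and \<open>q\<^sup>2\<close> are \<open>g z\<close>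
        and \<open>g w\<close>. The inequality
        \<open>2 * (p * q) \<le> p\<^sup>2 + q\<^sup>2\<close> may then be multiplied by the kernel
        because the kernel is nonnegative.\<close>
      define p q where "p = f z * mass z powr (-1/2)" and "q = f w * mass w powr (-1/2)"
      have sq: "(mass u powr (-1/2))\<^sup>2 = 1 / mass u" if "u \<in> space P" for u
        using mass_pos[OF that] by (simp add: power2_eq_square powr_add[symmetric] powr_minus_divide)
      have p2: "p\<^sup>2 = g z" and q2: "q\<^sup>2 = g w"
        using sq[OF z] sq[OF w] by (simp_all add: p_def q_def g_def power_mult_distrib)
      have "2 * (p * q) \<le> p\<^sup>2 + q\<^sup>2"
        using sum_squares_bound[of p q] by simp
      then have "inner (\<phi> z) (\<phi> w) * (2 * (p * q)) \<le> inner (\<phi> z) (\<phi> w) * (g z + g w)"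
        using inner_feature_nonneg[OF z w] unfolding p2 q2 by (rule mult_left_mono)
      then show "inner (feature z) (f w *\<^sub>R feature w) * f z
          \<le> g z / 2 * inner (\<phi> z) (\<phi> w) + inner (\<phi> z) (g w *\<^sub>R \<phi> w) / 2"
        by (simp add: inner_normalized_feature p_def q_def algebra_simps)
    qed
    also have "\<dots> = g z / 2 * mass z + inner (\<phi> z) V / 2"
      using integrable_feature gphi
      by (simp add: V_def mass_def del: inner_scaleR_right)
    also have "\<dots> = (f z)\<^sup>2 / 2 + inner (\<phi> z) V / 2"
      using mass_pos[OF z] by (simp add: g_def)
    finally show ?thesis .
  qed
  have "(norm (synth f))\<^sup>2 = (LINT z|P. inner (synth f) (feature z) * f z)"
    by (simp add: inner_synth[OF fi, symmetric] power2_norm_eq_inner)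
  also have "\<dots> \<le> (LINT z|P. (f z)\<^sup>2 / 2 + inner (\<phi> z) V / 2)"
  proof (rule integral_mono)
    have "integrable P (\<lambda>z. inner (synth f) (f z *\<^sub>R feature z))"
      using integrable_synth[OF fi] by (intro integrable_inner_right) auto
    then show "integrable P (\<lambda>z. inner (synth f) (feature z) * f z)"
      by (simp add: mult.commute)
    show "integrable P (\<lambda>z. (f z)\<^sup>2 / 2 + inner (\<phi> z) V / 2)"
      using f2 integrable_feature
      by (intro Bochner_Integration.integrable_add integrable_divide integrable_inner_left) auto
  qed (rule pointwise)
  also have "\<dots> = (LINT z|P. (f z)\<^sup>2) / 2 + inner (LINT z|P. \<phi> z) V / 2"
    using f2 integrable_feature by simp
  \<comment> \<open>Pairing the mean embedding with \<open>g w *\<^sub>R \<phi> w\<close> gives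
    \<open>g w * mass w\<close>, where the mass cancels. The second half therefore contributes the
    same integral of \<open>(f w)\<^sup>2\<close> as the first.\<close>
  also have "inner (LINT z|P. \<phi> z) V = (LINT w|P. inner (LINT z|P. \<phi> z) (g w *\<^sub>R \<phi> w))"
    unfolding V_def using gphi by (intro integral_inner_right[symmetric]) simp
  also have "\<dots> = (LINT w|P. (f w)\<^sup>2)"
  proof (rule Bochner_Integration.integral_cong[OF refl])
    fix w assume "w \<in> space P"
    then show "inner (LINT z|P. \<phi> z) (g w *\<^sub>R \<phi> w) = (f w)\<^sup>2"
      using mass_pos[of w] by (simp add: g_def mass_def inner_commute)
  qed
  finally show ?thesis by simp
qed

lemma inner_gram: "inner u (gram v) = (LINT z|P. inner u (feature z) * inner v (feature z))"
  unfolding gram_def by (rule inner_synth[OF in_L2_integrable[OF in_L2_inner_feature]])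

lemma gram_commute: "inner (gram u) v = inner u (gram v)"
  by (simp add: inner_gram inner_commute[of "gram u"] mult.commute)

text \<open>An operator inherits the norm bound of its adjoint. With \<open>a\<close> the squared
  norm of \<open>S v\<close>, Cauchy-Schwarz for \<open>a = inner v (gram v)\<close> and the bound
  \<open>(norm (gram v))\<^sup>2 \<le> a\<close> for \<open>S\<^sup>*\<close> applied to
  \<open>S v\<close> give \<open>a * a \<le> (norm v)\<^sup>2 * a\<close>; it remains to cancel
  \<open>a\<close> unless it is 0.\<close>

lemma integral_inner_feature_le: "(LINT z|P. (inner v (feature z))\<^sup>2) \<le> (norm v)\<^sup>2"
proof -
  define a where "a = (LINT z|P. (inner v (feature z))\<^sup>2)"
  have "a = inner v (gram v)" by (simp add: a_def inner_gram power2_eq_square)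
  also have "\<dots> \<le> norm v * norm (gram v)" by (rule norm_cauchy_schwarz)
  finally have 1: "a \<le> norm v * norm (gram v)" .
  have 2: "(norm (gram v))\<^sup>2 \<le> a"
    unfolding a_def gram_def by (rule norm_synth_le[OF in_L2_inner_feature])
  then have a0: "0 \<le> a" using zero_le_power2 order_trans by blast
  have "a * a \<le> (norm v)\<^sup>2 * (norm (gram v))\<^sup>2"
    using mult_mono[OF 1 1] a0 by (simp add: power2_eq_square mult_ac)
  also have "\<dots> \<le> (norm v)\<^sup>2 * a" using 2 by (intro mult_left_mono) auto
  finally show ?thesis using a0 unfolding a_def[symmetric]
    by (cases "a = 0") auto
qed

lemma norm_gram_le: "norm (gram v) \<le> norm v"
proof -
  have "(norm (gram v))\<^sup>2 \<le> (norm v)\<^sup>2"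
    using norm_synth_le[OF in_L2_inner_feature] integral_inner_feature_le
    unfolding gram_def by (rule order_trans)
  then show ?thesis by (simp add: power2_le_iff_abs_le)
qed

lemma bounded_linear_gram: "bounded_linear gram"
proof (rule bounded_linear_intro[where K = 1])
  have i: "integrable P (\<lambda>z. inner v (feature z) *\<^sub>R feature z)" for v
    by (rule integrable_synth[OF in_L2_integrable[OF in_L2_inner_feature]])
  show "gram (u + v) = gram u + gram v" for u v
    using i[of u] i[of v] by (simp add: gram_def synth_def inner_add_left scaleR_add_left)
  show "gram (r *\<^sub>R v) = r *\<^sub>R gram v" for r v
    by (simp add: gram_def synth_def flip: scaleR_scaleR)
qed (simp add: norm_gram_le)

lemma L2_nrm_inner_feature_le: "L2_nrm P (\<lambda>z. inner v (feature z)) \<le> norm v"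
  unfolding L2_nrm_def by (rule real_le_lsqrt) (auto intro: integral_inner_feature_le)

text \<open>Minkowski's inequality for two features, with a weighted AM-GM inequality absorbing the cross
  term. The function \<open>h\<close> need not be measurable: if its square is not integrable, the Bochner
  integral is 0. For \<open>e = 0\<close> the terms divided by \<open>e\<close> vanish, as does \<open>v\<close>.\<close>

lemma L2_nrm_le_two_features:
  assumes h: "\<And>y. y \<in> space P \<Longrightarrow>
      \<bar>h y\<bar> \<le> a * \<bar>inner u (feature y)\<bar> + b * \<bar>inner v (feature y)\<bar>"
    and "0 \<le> a" "0 \<le> b" "0 \<le> r" "0 \<le> e" and u: "norm u \<le> r" and v: "norm v \<le> e * r"
  shows "L2_nrm P h \<le> r * (a + b * e)"
proof -
  let ?p = "\<lambda>y. inner u (feature y)" and ?q = "\<lambda>y. inner v (feature y)"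
  have p: "integrable P (\<lambda>y. (?p y)\<^sup>2)" and q: "integrable P (\<lambda>y. (?q y)\<^sup>2)"
    using in_L2_inner_feature by (auto simp: in_L2_def)
  have pb: "(LINT y|P. (?p y)\<^sup>2) \<le> r\<^sup>2"
    using integral_inner_feature_le[of u] power_mono[OF u, of 2] by simp
  have qb: "(LINT y|P. (?q y)\<^sup>2) \<le> (e * r)\<^sup>2"
    using integral_inner_feature_le[of v] power_mono[OF v, of 2] by simp
  \<comment> \<open>The weight \<open>e\<close> balances the two halves of the cross term: after
    inserting the bounds \<open>r\<^sup>2\<close> and \<open>(e * r)\<^sup>2\<close> each becomes
    \<open>a * b * e * r\<^sup>2\<close>, which completes the square of
    \<open>r * (a + b * e)\<close>.\<close>
  let ?F = "\<lambda>y. (a\<^sup>2 + a * b * e) * (?p y)\<^sup>2 + (b\<^sup>2 + a * b / e) * (?q y)\<^sup>2"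
  have "(LINT y|P. (h y)\<^sup>2) \<le> (LINT y|P. ?F y)"
  proof (rule integral_mono')
    show "integrable P ?F"
      using p q by (intro Bochner_Integration.integrable_add integrable_mult_right)
    fix y assume y: "y \<in> space P"
    show "0 \<le> ?F y" using assms by simp
    have "2 * (\<bar>?p y\<bar> * \<bar>?q y\<bar>) \<le> e * (?p y)\<^sup>2 + (?q y)\<^sup>2 / e"
    proof (cases "e = 0")
      case True
      then show ?thesis using v by simp
    next
      case False
      then have "e > 0" using \<open>0 \<le> e\<close> by simp
      moreover have "0 \<le> (e * \<bar>?p y\<bar> - \<bar>?q y\<bar>)\<^sup>2" by simp
      ultimately show ?thesis
        by (simp add: field_simps power2_eq_square)
    qed
    from mult_left_mono[OF this, of "a * b"]
    have "a * b * (2 * (\<bar>?p y\<bar> * \<bar>?q y\<bar>)) \<le> a * b * (e * (?p y)\<^sup>2 + (?q y)\<^sup>2 / e)"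
      using assms by simp
    then have "(a * \<bar>?p y\<bar> + b * \<bar>?q y\<bar>)\<^sup>2 \<le> ?F y"
      by (simp add: power2_sum power_mult_distrib algebra_simps)
    moreover have "(h y)\<^sup>2 \<le> (a * \<bar>?p y\<bar> + b * \<bar>?q y\<bar>)\<^sup>2"
      using power_mono[OF h[OF y], of 2] by simp
    ultimately show "(h y)\<^sup>2 \<le> ?F y" by simp
  qed
  also have "\<dots> = (a\<^sup>2 + a * b * e) * (LINT y|P. (?p y)\<^sup>2) + (b\<^sup>2 + a * b / e) * (LINT y|P. (?q y)\<^sup>2)"
    using p q by simp
  also have "\<dots> \<le> (a\<^sup>2 + a * b * e) * r\<^sup>2 + (b\<^sup>2 + a * b / e) * (e * r)\<^sup>2"
    using pb qb assms by (intro add_mono mult_left_mono) auto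
  also have "\<dots> = (r * (a + b * e))\<^sup>2"
    by (cases "e = 0") (auto simp: field_simps power2_eq_square)
  finally show ?thesis
    unfolding L2_nrm_def using assms by (intro real_le_lsqrt) auto
qed

section \<open>A self-adjoint perturbation of \<open>gram\<close> with rescaled features\<close>

context
  fixes Q :: "'h \<Rightarrow> 'h" and \<kappa> :: "'a \<Rightarrow> real" and d s t :: real and k :: nat
  assumes Q: "bounded_linear Q" and Q_commute: "\<And>u v. inner (Q u) v = inner u (Q v)"
    and Qd: "\<And>v. norm (Q v - gram v) \<le> d * norm v" and d: "0 \<le> d"
    and \<kappa>s: "\<And>y. y \<in> space P \<Longrightarrow> \<bar>\<kappa> y\<bar> \<le> s"
    and \<kappa>t: "\<And>y. y \<in> space P \<Longrightarrow> \<bar>\<kappa> y - 1\<bar> \<le> t"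
begin


text \<open>In the application \<open>Q\<close> is the empirical operator, \<open>\<kappa>\<close>
  is \<open>chi\<close>, and \<open>k\<close> is \<open>m - 1\<close>; then
  \<open>inner (defect y) (feature z)\<close> is the difference of the ideal and the empirical
  representation of \<open>y\<close>, evaluated at \<open>z\<close>.\<close>

definition defect :: "'a \<Rightarrow> 'h"
  where "defect y = (gram ^^ k) (feature y) - (Q ^^ k) (\<kappa> y *\<^sub>R feature y)"

definition power_gap :: real
  where "power_gap = real k * d * (1 + d) ^ (k - 1)"

lemma power_gap_nonneg: "0 \<le> power_gap"
  using d by (simp add: power_gap_def)

lemma norm_power_diff_le: "norm ((gram ^^ k) v - (Q ^^ k) v) \<le> power_gap * norm v"
  unfolding power_gap_def
  using funpow_diff_norm_le[OF bounded_linear.linear[OF bounded_linear_gram] norm_gram_le Qd d] .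

lemma norm_gram_power_le: "norm ((gram ^^ k) v) \<le> norm v"
  using funpow_norm_le[of gram 1 k v] norm_gram_le by simp

text \<open>Adding and subtracting \<open>\<kappa> y *\<^sub>R (gram ^^ k) (feature y)\<close>
  separates the error of the normalization, controlled by \<open>t\<close>, from that of the
  operator, controlled by \<open>s\<close> and \<open>power_gap\<close>.\<close>

lemma defect_eq:
  "defect y = (1 - \<kappa> y) *\<^sub>R (gram ^^ k) (feature y)
    + \<kappa> y *\<^sub>R ((gram ^^ k) (feature y) - (Q ^^ k) (feature y))"
  using linear_scale[OF bounded_linear.linear[OF funpow_bounded_linear[OF Q]], of k "\<kappa> y" "feature y"]
  by (simp add: defect_def algebra_simps)

lemma norm_defect_le:
  assumes y: "y \<in> space P"
  shows "norm (defect y) \<le> mass y powr (-1/2) * (s * power_gap + t)"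
proof -
  have "norm (defect y) \<le> \<bar>1 - \<kappa> y\<bar> * norm ((gram ^^ k) (feature y))
      + \<bar>\<kappa> y\<bar> * norm ((gram ^^ k) (feature y) - (Q ^^ k) (feature y))"
    unfolding defect_eq by (rule order_trans[OF norm_triangle_ineq]) simp
  also have "\<dots> \<le> t * norm (feature y) + s * (power_gap * norm (feature y))"
    using \<kappa>s[OF y] \<kappa>t[OF y] norm_gram_power_le norm_power_diff_le
    by (intro add_mono mult_mono) (auto simp: abs_minus_commute intro: order_trans[OF abs_ge_zero])
  also have "\<dots> = norm (feature y) * (s * power_gap + t)"
    by (simp add: algebra_simps)
  also have "\<dots> \<le> mass y powr (-1/2) * (s * power_gap + t)"
  proof (rule mult_right_mono)
    show "norm (feature y) \<le> mass y powr (-1/2)"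
      using mult_left_mono[OF norm_feature_le[OF y], of "mass y powr (-1/2)"]
      by (simp add: feature_def)
    have "0 \<le> s" "0 \<le> t"
      using \<kappa>s[OF y] \<kappa>t[OF y] by linarith+
    then show "0 \<le> s * power_gap + t" using power_gap_nonneg by simp
  qed
  finally show ?thesis .
qed

lemma L2_nrm_defect_le:
  assumes "y \<in> space P"
  shows "L2_nrm P (\<lambda>z. inner (defect y) (feature z)) \<le> mass y powr (-1/2) * (s * power_gap + t)"
  using L2_nrm_inner_feature_le norm_defect_le[OF assms] by (rule order_trans)

text \<open>Both operators are self-adjoint, so they can be moved from the representation of \<open>y\<close> to the
  fixed vector \<open>synth f\<close>, and the \<open>L\<^sup>2\<close> bounds for \<open>\<lambda>y. inner v (feature y)\<close> apply.\<close>

lemma L2_nrm_L2_inner_defect_le: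
  assumes f: "in_L2 P f"
  shows "L2_nrm P (\<lambda>y. L2_inner P (\<lambda>z. inner (defect y) (feature z)) f)
    \<le> L2_nrm P f * (s * power_gap + t)"
proof -
  define h where "h = synth f"
  let ?u = "(gram ^^ k) h" and ?v = "(gram ^^ k) h - (Q ^^ k) h"
  have h: "norm h \<le> L2_nrm P f"
    unfolding h_def L2_nrm_def by (rule real_le_rsqrt) (rule norm_synth_le[OF f])
  \<comment> \<open>The bounds \<open>s\<close> and \<open>t\<close> are known to dominate absolute
    values only at points of \<open>space P\<close>, so their signs follow from the existence of
    such a point.\<close>
  obtain y0 where "y0 \<in> space P" using not_empty by blast
  then have nn: "0 \<le> s" "0 \<le> t" using \<kappa>s[of y0] \<kappa>t[of y0] by linarith+
  \<comment> \<open>Bounding \<open>norm (defect y)\<close> pointwise would leave a factor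
    \<open>mass y powr (-1/2)\<close>. With the fixed vectors \<open>?u\<close> and
    \<open>?v\<close>, the feature of \<open>y\<close> is absorbed by the contractivity of
    \<open>S\<close> in the variable \<open>y\<close>.\<close>
  have "L2_nrm P (\<lambda>y. L2_inner P (\<lambda>z. inner (defect y) (feature z)) f)
      \<le> L2_nrm P f * (t + s * power_gap)"
  proof (rule L2_nrm_le_two_features[where u = ?u and v = ?v])
    fix y assume y: "y \<in> space P"
    have "L2_inner P (\<lambda>z. inner (defect y) (feature z)) f = inner (defect y) h"
      unfolding L2_inner_def h_def by (rule inner_synth[OF in_L2_integrable[OF f], symmetric])
    also have "\<dots> = (1 - \<kappa> y) * inner ?u (feature y) + \<kappa> y * inner ?v (feature y)"
      unfolding defect_eq
      by (simp add: inner_add_left inner_diff_left inner_diff_right inner_commute[of _ "feature y"]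
          funpow_inner_commute[of gram, OF gram_commute] funpow_inner_commute[of Q, OF Q_commute])
    also have "\<bar>\<dots>\<bar> \<le> \<bar>1 - \<kappa> y\<bar> * \<bar>inner ?u (feature y)\<bar> + \<bar>\<kappa> y\<bar> * \<bar>inner ?v (feature y)\<bar>"
      by (rule order_trans[OF abs_triangle_ineq]) (simp add: abs_mult)
    also have "\<dots> \<le> t * \<bar>inner ?u (feature y)\<bar> + s * \<bar>inner ?v (feature y)\<bar>"
      using \<kappa>s[OF y] \<kappa>t[OF y] by (intro add_mono mult_right_mono) auto
    finally show "\<bar>L2_inner P (\<lambda>z. inner (defect y) (feature z)) f\<bar>
        \<le> t * \<bar>inner ?u (feature y)\<bar> + s * \<bar>inner ?v (feature y)\<bar>" .
  next
    show "norm ?u \<le> L2_nrm P f" using norm_gram_power_le h by (rule order_trans)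
    show "norm ?v \<le> power_gap * L2_nrm P f"
      using norm_power_diff_le mult_left_mono[OF h power_gap_nonneg] by (rule order_trans)
    show "0 \<le> L2_nrm P f" by (simp add: L2_nrm_def)
  qed (use nn power_gap_nonneg in auto)
  then show ?thesis by (simp add: add.commute)
qed

end

end

section \<open>The Gaussian kernel and its feature map\<close>

lemma gauss_kernel_le_1: "0 \<le> \<beta> \<Longrightarrow> gauss_kernel \<beta> x y \<le> 1"
  by (simp add: gauss_kernel_def)

text \<open>If \<open>e\<close> bounds all distances within \<open>X\<close>, the kernel is at least
  \<open>exp (- \<beta> * e\<^sup>2)\<close> there. Averaging keeps this bound, so it holds for both
  the ideal and the empirical degree.\<close>

lemma gauss_kernel_bounded_below:
  assumes "bounded X" "0 < \<beta>"
  obtains c where "0 < c" "\<And>y z. y \<in> X \<Longrightarrow> z \<in> X \<Longrightarrow> c \<le> gauss_kernel \<beta> y z"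
proof -
  obtain e where e: "\<And>y z. y \<in> X \<Longrightarrow> z \<in> X \<Longrightarrow> dist y z \<le> e"
    using assms(1) unfolding bounded_two_points by blast
  have "exp (- \<beta> * e\<^sup>2) \<le> gauss_kernel \<beta> y z" if "y \<in> X" "z \<in> X" for y z
  proof -
    have "(norm (y - z))\<^sup>2 \<le> e\<^sup>2"
      using e[OF that] by (intro power_mono) (auto simp: dist_norm)
    then show ?thesis using assms(2) by (simp add: gauss_kernel_def)
  qed
  then show ?thesis using that[of "exp (- \<beta> * e\<^sup>2)"] by simp
qed

text \<open>The kernel determines distances between features: the squared norm of
  \<open>\<phi> y - \<phi> x\<close> is \<open>2 - 2 * gauss_kernel \<beta> y x\<close>, which tends
  to 0 as \<open>y\<close> tends to \<open>x\<close>. Continuity is what makes \<open>\<phi>\<close>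
  Borel measurable.\<close>

lemma gauss_feature_continuous:
  fixes \<phi> :: "'a::real_inner \<Rightarrow> 'h::real_inner"
  assumes K: "\<And>y z. y \<in> X \<Longrightarrow> z \<in> X \<Longrightarrow> gauss_kernel \<beta> y z = inner (\<phi> y) (\<phi> z)"
  shows "continuous_on X \<phi>"
  unfolding continuous_on_def
proof
  fix x assume x: "x \<in> X"
  have eq: "norm (\<phi> y - \<phi> x) = sqrt (2 - 2 * gauss_kernel \<beta> y x)" if "y \<in> X" for y
  proof -
    have "gauss_kernel \<beta> z z = 1" for z :: 'a by (simp add: gauss_kernel_def)
    then have "(norm (\<phi> y - \<phi> x))\<^sup>2 = 2 - 2 * gauss_kernel \<beta> y x"
      using K[OF that that] K[OF that x] K[OF x x]
      by (simp add: power2_norm_eq_inner algebra_simps inner_commute)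
    then show ?thesis by (metis norm_ge_zero real_sqrt_unique)
  qed
  have "((\<lambda>y. sqrt (2 - 2 * gauss_kernel \<beta> y x)) \<longlongrightarrow> sqrt (2 - 2 * gauss_kernel \<beta> x x)) (at x within X)"
    unfolding gauss_kernel_def by (intro tendsto_intros)
  then have "((\<lambda>y. sqrt (2 - 2 * gauss_kernel \<beta> y x)) \<longlongrightarrow> 0) (at x within X)"
    by (simp add: gauss_kernel_def)
  moreover have "eventually (\<lambda>y. sqrt (2 - 2 * gauss_kernel \<beta> y x) = norm (\<phi> y - \<phi> x)) (at x within X)"
    unfolding eventually_at_filter by (intro always_eventually) (simp add: eq)
  ultimately have "((\<lambda>y. norm (\<phi> y - \<phi> x)) \<longlongrightarrow> 0) (at x within X)"
    by (rule Lim_transform_eventually)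
  then show "(\<phi> \<longlongrightarrow> \<phi> x) (at x within X)"
    by (simp add: tendsto_norm_zero_iff LIM_zero_iff)
qed

lemma gauss_normalized_features:
  fixes \<phi> :: "'a::real_inner \<Rightarrow> 'h::{real_inner,banach,second_countable_topology}"
  assumes "prob_space P" and sets: "sets P = sets (restrict_space borel X)"
    and K: "\<And>y z. y \<in> X \<Longrightarrow> z \<in> X \<Longrightarrow> gauss_kernel \<beta> y z = inner (\<phi> y) (\<phi> z)"
    and "0 < c" and c: "\<And>y z. y \<in> X \<Longrightarrow> z \<in> X \<Longrightarrow> c \<le> gauss_kernel \<beta> y z"
  shows "normalized_features P \<phi> c"
proof -
  interpret prob_space P by fact
  have X: "space P = X"
    using sets_eq_imp_space_eq[OF sets] by (simp add: space_restrict_space)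
  have meas: "\<phi> \<in> borel_measurable P"
    using borel_measurable_continuous_on_restrict[OF gauss_feature_continuous[OF K]]
      measurable_cong_sets[OF sets refl] by blast
  have norm: "norm (\<phi> z) = 1" if "z \<in> X" for z
    using K[OF that that] by (simp add: gauss_kernel_def norm_eq_1)
  have int: "integrable P \<phi>"
    using meas norm X by (intro integrable_const_bound[where B = 1]) auto
  show ?thesis
  proof
    show "\<phi> \<in> borel_measurable P" by fact
    show "0 < c" by fact
    show "c \<le> inner (\<phi> z) (LINT w|P. \<phi> w)" if "z \<in> space P" for z
    proof -
      have "c \<le> (LINT w|P. inner (\<phi> z) (\<phi> w))"
        using int c K that X by (intro integral_ge_const integrable_inner_right) auto
      then show ?thesis using int by simp
    qed
    show "norm (\<phi> z) \<le> 1" if "z \<in> space P" for z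
      using norm that X by simp
    show "0 \<le> inner (\<phi> y) (\<phi> z)" if "y \<in> space P" "z \<in> space P" for y z
      using K[of y z] that X by (simp add: gauss_kernel_def flip: K)
  qed
qed

section \<open>The empirical operator and the empirical degree\<close>

lemma Q_hat_bounded_linear: "bounded_linear (Q_hat n xs \<beta> \<phi>)"
  unfolding Q_hat_def
  by (intro bounded_linear_const_scaleR bounded_linear_sum bounded_linear_scaleR_const
      bounded_linear_const_mult bounded_linear_inner_left bounded_linear_ident)

lemma Q_hat_commute: "inner (Q_hat n xs \<beta> \<phi> u) v = inner u (Q_hat n xs \<beta> \<phi> v)"
  by (simp add: Q_hat_def inner_sum_left inner_sum_right inner_commute mult_ac)

lemma mu_hat_ge:
  assumes "n \<ge> 1" and c: "\<And>i. i \<in> {1..n} \<Longrightarrow> c \<le> gauss_kernel \<beta> y (xs i)"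
  shows "c \<le> mu_hat n xs \<beta> y"
proof -
  have "real n * c \<le> (\<Sum>i=1..n. gauss_kernel \<beta> y (xs i))"
    using sum_mono[of "{1..n}" "\<lambda>_. c", OF c] by simp
  then show ?thesis
    using \<open>n \<ge> 1\<close> by (simp add: mu_hat_def field_simps)
qed

section \<open>Both bounds for the Gaussian kernel\<close>

theorem proposition9:
  fixes X :: "'a::{real_inner,complete_space,second_countable_topology} set"
    and P :: "'a measure"
    and \<beta> :: real
    and evl :: "'h::{real_inner,banach,second_countable_topology} \<Rightarrow> 'a \<Rightarrow> real"
    and \<phi> :: "'a \<Rightarrow> 'h"
    and M :: "'w measure"
    and n :: nat
    and Xs :: "nat \<Rightarrow> 'w \<Rightarrow> 'a"
    and \<omega> :: 'w
    and x :: 'a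
    and f :: "'a \<Rightarrow> real"
    and m :: nat
  assumes "compact X"
    and "prob_space P"
    and "sets P = sets (restrict_space borel X)"
    and "finite (components (measure_supp P))"
    and "\<And>C. C \<in> components (measure_supp P) \<Longrightarrow> compact C"
    and "\<beta> > 0"
    and "is_rkhs X (gauss_kernel \<beta>) evl"
    and "\<And>y z. y \<in> X \<Longrightarrow> z \<in> X \<Longrightarrow> gauss_kernel \<beta> y z = inner (\<phi> y) (\<phi> z)"
    and "prob_space M"
    and "n \<ge> 1"
    and "prob_space.indep_vars M (\<lambda>_. restrict_space borel X) Xs {1..n}"
    and "\<And>i. i \<in> {1..n} \<Longrightarrow> distr M (restrict_space borel X) (Xs i) = P"
    and "\<omega> \<in> space M"
    and "x \<in> measure_supp P"
    and "in_L2 P f"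
    and "m > 0"
  shows
    "let xs = (\<lambda>i. Xs i \<omega>);
         \<delta> = onorm (\<lambda>v. Q_hat n xs \<beta> \<phi> v - G_op P \<beta> \<phi> v);
         B = (real m - 1) * sup_nrm X (chi P n xs \<beta>) * \<delta> * (1 + \<delta>) powi (int m - 2)
             + sup_nrm X (\<lambda>y. chi P n xs \<beta> y - 1);
         D = (\<lambda>y z. R_rep P \<beta> \<phi> m y z - R_hat P n xs \<beta> \<phi> m y z)
     in L2_nrm P (D x) \<le> mu P \<beta> x powr (-1/2) * B \<and>
        sqrt (LINT y|P. (L2_inner P (D y) f)\<^sup>2) \<le> L2_nrm P f * B"
proof -
  define xs where "xs = (\<lambda>i. Xs i \<omega>)"
  have X: "space P = X"
    using sets_eq_imp_space_eq[OF assms(3)] by (simp add: space_restrict_space)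
  have x: "x \<in> X"
    using assms(14) X by (simp add: measure_supp_def)
  have xs: "xs i \<in> X" if "i \<in> {1..n}" for i
  proof -
    have "Xs i \<in> measurable M (restrict_space borel X)"
      using assms(11) that unfolding prob_space.indep_vars_def[OF assms(9)] by blast
    from measurable_space[OF this assms(13)] show ?thesis
      by (simp add: xs_def space_restrict_space)
  qed
  obtain c where c: "0 < c" "\<And>y z. y \<in> X \<Longrightarrow> z \<in> X \<Longrightarrow> c \<le> gauss_kernel \<beta> y z"
    using gauss_kernel_bounded_below[OF compact_imp_bounded[OF assms(1)] assms(6)] by blast
  interpret normalized_features P \<phi> c
    using gauss_normalized_features[OF assms(2,3,8) c] .
  have mass: "mu P \<beta> y = mass y" if "y \<in> X" for y
  proof -
    have "mu P \<beta> y = (LINT z|P. inner (\<phi> y) (\<phi> z))"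
      unfolding mu_def using assms(8)[OF that] X by (intro Bochner_Integration.integral_cong) auto
    then show ?thesis using integrable_feature by (simp add: mass_def)
  qed
  have mass_le: "mass y \<le> 1" if "y \<in> X" for y
  proof -
    have "(LINT z|P. inner (\<phi> y) (\<phi> z)) \<le> 1"
      using that X gauss_kernel_le_1[of \<beta> y] assms(6) integrable_feature
      by (intro integral_le_const integrable_inner_right) (auto simp flip: assms(8))
    then show ?thesis using integrable_feature by (simp add: mass_def)
  qed
  have bar: "phi_bar P \<beta> \<phi> y = feature y" if "y \<in> X" for y
    using mass[OF that] by (simp add: phi_bar_def feature_def)
  have G: "G_op P \<beta> \<phi> = gram"
    unfolding G_op_def gram_def synth_def using bar X
    by (intro ext Bochner_Integration.integral_cong) auto
  let ?\<kappa> = "chi P n xs \<beta>" and ?Q = "Q_hat n xs \<beta> \<phi>"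
  have hat_ge: "c \<le> mu_hat n xs \<beta> y" if "y \<in> X" for y
    using mu_hat_ge[of n c \<beta> y xs] assms(10) c(2)[OF that xs] by simp
  have hat: "phi_hat n xs \<beta> \<phi> y = ?\<kappa> y *\<^sub>R feature y" if y: "y \<in> X" for y
  proof -
    have "0 < mu_hat n xs \<beta> y" "0 < mass y"
      using hat_ge[OF y] c(1) mass_pos y X by auto
    then have "mu_hat n xs \<beta> y powr (-1/2) = ?\<kappa> y * mass y powr (-1/2)"
      by (simp add: chi_def mass[OF y] real_sqrt_divide powr_minus_divide powr_half_sqrt)
    then show ?thesis by (simp add: phi_hat_def feature_def)
  qed
  \<comment> \<open>The supremum in \<open>sup_nrm\<close> dominates the values of
    \<open>chi\<close> only if these are bounded above. The bound comes from
    \<open>mass y \<le> 1\<close> in the numerator and \<open>c\<close> in the denominator.\<close>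
  have chi: "0 \<le> ?\<kappa> y" "?\<kappa> y \<le> sqrt (1 / c)" if y: "y \<in> X" for y
  proof -
    have "0 < mass y" using mass_pos y X by auto
    then have "0 \<le> mass y / mu_hat n xs \<beta> y" "mass y / mu_hat n xs \<beta> y \<le> 1 / c"
      using hat_ge[OF y] c(1) mass_le[OF y] by (auto intro!: frac_le)
    then show "0 \<le> ?\<kappa> y" "?\<kappa> y \<le> sqrt (1 / c)"
      by (simp_all add: chi_def mass[OF y] flip: real_sqrt_divide)
  qed
  define s t where "s = sup_nrm X ?\<kappa>" and "t = sup_nrm X (\<lambda>y. ?\<kappa> y - 1)"
  have s: "\<bar>?\<kappa> y\<bar> \<le> s" if "y \<in> space P" for y
    unfolding s_def sup_nrm_def using that X chi
    by (intro cSUP_upper bdd_aboveI2[where M = "sqrt (1 / c)"]) auto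
  have "\<bar>?\<kappa> y - 1\<bar> \<le> sqrt (1 / c) + 1" if "y \<in> X" for y
    using chi[OF that] by linarith
  then have t: "\<bar>?\<kappa> y - 1\<bar> \<le> t" if "y \<in> space P" for y
    unfolding t_def sup_nrm_def using that X
    by (intro cSUP_upper bdd_aboveI2[where M = "sqrt (1 / c) + 1"]) auto
  define \<delta> where "\<delta> = onorm (\<lambda>v. ?Q v - G_op P \<beta> \<phi> v)"
  have bl: "bounded_linear (\<lambda>v. ?Q v - gram v)"
    by (intro bounded_linear_sub Q_hat_bounded_linear bounded_linear_gram)
  have d: "norm (?Q v - gram v) \<le> \<delta> * norm v" for v
    using onorm[OF bl] by (simp add: \<delta>_def G)
  have d0: "0 \<le> \<delta>"
    using onorm_pos_le[OF bl] by (simp add: \<delta>_def G)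
  note Q_facts = Q_hat_bounded_linear Q_hat_commute d d0 s t
  let ?e = "defect ?Q ?\<kappa> (m - 1)"
  have power_gap: "power_gap \<delta> (m - 1) = real (m - 1) * \<delta> * (1 + \<delta>) ^ (m - 1 - 1)"
    by (rule power_gap_def[where \<kappa> = ?\<kappa>, OF Q_facts])
  \<comment> \<open>The integer exponent \<open>int m - 2\<close> is compared with the truncated
    natural number \<open>m - 1 - 1\<close>. They differ only for \<open>m = 1\<close>, where the
    integer exponent is -1 but the factor \<open>real m - 1\<close> vanishes.\<close>
  have gap: "s * power_gap \<delta> (m - 1) + t = (real m - 1) * s * \<delta> * (1 + \<delta>) powi (int m - 2) + t"
  proof (cases "m = 1")
    case True
    then show ?thesis using power_gap by simp
  next
    case False
    then have "m \<ge> 2" using assms(16) by simp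
    then obtain j where "m = j + 2" using le_Suc_ex by (metis add.commute)
    then show ?thesis using power_gap by (simp add: add.commute)
  qed
  have D: "R_rep P \<beta> \<phi> m y z - R_hat P n xs \<beta> \<phi> m y z = inner (?e y) (feature z)"
    if "y \<in> X" "z \<in> X" for y z
    using that by (simp add: R_rep_def R_hat_def bar hat G defect_def[where \<kappa> = ?\<kappa>, OF Q_facts] inner_diff_left)
  \<comment> \<open>The identity \<open>D\<close> is available on \<open>X\<close> only, where
    \<open>phi_bar\<close> agrees with \<open>feature\<close>; it passes to the integrals because
    \<open>space P = X\<close>.\<close>
  have D1: "L2_nrm P (\<lambda>z. R_rep P \<beta> \<phi> m x z - R_hat P n xs \<beta> \<phi> m x z)
      = L2_nrm P (\<lambda>z. inner (?e x) (feature z))"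
    unfolding L2_nrm_def using D[OF x] X
    by (intro arg_cong[where f = sqrt] Bochner_Integration.integral_cong) auto
  have D2: "L2_inner P (\<lambda>z. R_rep P \<beta> \<phi> m y z - R_hat P n xs \<beta> \<phi> m y z) f
      = L2_inner P (\<lambda>z. inner (?e y) (feature z)) f" if "y \<in> X" for y
    unfolding L2_inner_def using D[OF that] X by (intro Bochner_Integration.integral_cong) auto
  have D3: "sqrt (LINT y|P. (L2_inner P (\<lambda>z. R_rep P \<beta> \<phi> m y z - R_hat P n xs \<beta> \<phi> m y z) f)\<^sup>2)
      = L2_nrm P (\<lambda>y. L2_inner P (\<lambda>z. inner (?e y) (feature z)) f)"
    unfolding L2_nrm_def using D2 X
    by (intro arg_cong[where f = sqrt] Bochner_Integration.integral_cong) auto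
  show ?thesis
    unfolding Let_def xs_def[symmetric] \<delta>_def[symmetric] s_def[symmetric] t_def[symmetric]
      D1 D3 gap[symmetric] mass[OF x]
    using L2_nrm_defect_le[where \<kappa> = ?\<kappa>, OF Q_facts, of x]
      L2_nrm_L2_inner_defect_le[where \<kappa> = ?\<kappa>, OF Q_facts assms(15)] x X
    by blast
qed

end
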